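(* For a positive integer $n$, identify the additive group of $\mathbb{F}_{2^n}\times\mathbb{F}_{2^n}$ with $\mathbb{Z}_2^{2n}$ via a group isomorphism, and let $S_{2n}=\{(x,x^3)\mid x\in\mathbb{F}_{2^n}\}$. Then there exist a constant $c>0$ and an integer $n_0$ such that for all $n>n_0$, every element of $\mathbb{Z}_2^{2n}\setminus S_{2n}$ (equivalently, every $(x,y)\in\mathbb{F}_{2^n}^2$ with $y\neq x^3$) is covered at least $c\cdot 2^n$ times by $S_{2n}$; that is, the number of covers is $\Omega(2^n)$.
   Context: A subset $S\subseteq\mathbb{Z}_2^n$ is called Sidon if whenever $a+b=x+y$ with $a,b,x,y\in S$, $a\neq b$, $x\neq y$, we have $\{a,b\}=\{x,y\}$ (i.e. sums of pairs of distinct elements are distinct). The set $S_{2n}$ above is a Sidon set. For a Sidon set $S\subseteq\mathbb{Z}_2^N$, a point $x\in\mathbb{Z}_2^N\setminus S$ is said to be covered $k$ times by $S$ if there are exactly $k$ distinct unordered triples $\{a,b,c\}$ with $a,b,c\in S$ and $a+b+c=x$. *)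

theory Defs
  imports Complex_Main "HOL-Algebra.Algebra"
begin

definition Z2_power :: "nat \<Rightarrow> (nat \<Rightarrow> int) monoid" where
  "Z2_power N = product_group {..<N} (\<lambda>_. integer_mod_group 2)"

definition cube_graph :: "('a, 'm) ring_scheme \<Rightarrow> ('a \<times> 'a) set" where
  "cube_graph F = {(x, x [^]\<^bsub>F\<^esub> (3::nat)) | x. x \<in> carrier F}"

text \<open>
  The unordered triples are taken as sets \<open>{a, b, c}\<close>. No distinctness condition is needed:
  in an elementary abelian 2-group a sum of three elements of \<open>S\<close> with a repetition lies in
  \<open>S\<close>, while only points outside \<open>S\<close> are considered.
\<close>

definition covers :: "('g, 'm) monoid_scheme \<Rightarrow> 'g set \<Rightarrow> 'g \<Rightarrow> 'g set set" where
  "covers G S x = {{a, b, c} | a b c. a \<in> S \<and> b \<in> S \<and> c \<in> S \<and> a \<otimes>\<^bsub>G\<^esub> b \<otimes>\<^bsub>G\<^esub> c = x}"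

end

theory Submission
  imports Defs
begin

text \<open>
  In characteristic 2, \<open>(a + b + c)\<^sup>3 = a\<^sup>3 + b\<^sup>3 + c\<^sup>3 + (a + b)(b + c)(c + a)\<close>. Hence, with
  \<open>t = x\<^sup>3 + y \<noteq> 0\<close>, the covers of \<open>(x, y)\<close> come from the solutions of \<open>u v (u + v) = t\<close>, and
  the substitution \<open>v = 1/w\<close>, \<open>u = z/w\<close> turns this equation into \<open>z\<^sup>2 + z = t w\<^sup>3\<close>.
  The Artin-Schreier image \<open>{z\<^sup>2 + z}\<close> is an additive subgroup of index 2; the character
  \<open>\<chi>\<close> with this kernel satisfies \<open>\<chi>(z\<^sup>2) = \<chi>(z)\<close>. Solutions are therefore counted by the sum of
  \<open>\<chi>(t w\<^sup>3)\<close> over \<open>w\<close>. Squaring the sum and differencing makes the inner sums linear in \<open>w\<close>; they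
  vanish unless \<open>t h = (t h\<^sup>2)\<^sup>2\<close>, which has at most four solutions \<open>h\<close>. So the sum
  is at most \<open>2 \<surd>q\<close> in absolute value, where \<open>q = 2\<^sup>n\<close>, and there are at least \<open>q - 2 \<surd>q - 2\<close>
  solutions.
\<close>

section \<open>Transport of covers along a group isomorphism\<close>

text \<open>Taking images under \<open>f\<close> is a bijection between the two families of covers:
  \<open>f\<close> is multiplicative and injective on the carrier, so the defining equation
  transfers in both directions, and distinct subsets of the carrier have distinct images.\<close>

lemma card_covers_iso:
  assumes G: "monoid G" and f: "f \<in> iso G H" and S: "S \<subseteq> carrier G" and x: "x \<in> carrier G"
  shows "card (covers H (f ` S) (f x)) = card (covers G S x)"
proof -
  interpret monoid G by (rule G)
  have inj: "inj_on f (carrier G)"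
    using f by (simp add: iso_def bij_betw_def)
  have mult: "f (a \<otimes>\<^bsub>G\<^esub> b) = f a \<otimes>\<^bsub>H\<^esub> f b" if "a \<in> carrier G" "b \<in> carrier G" for a b
    using f that by (auto simp: iso_def hom_def)
  have sum_eq: "f a \<otimes>\<^bsub>H\<^esub> f b \<otimes>\<^bsub>H\<^esub> f c = f x \<longleftrightarrow> a \<otimes>\<^bsub>G\<^esub> b \<otimes>\<^bsub>G\<^esub> c = x"
    if "a \<in> S" "b \<in> S" "c \<in> S" for a b c
  proof -
    have "a \<in> carrier G" "b \<in> carrier G" "c \<in> carrier G"
      using that S by auto
    then show ?thesis
      using inj_onD[OF inj, of "a \<otimes>\<^bsub>G\<^esub> b \<otimes>\<^bsub>G\<^esub> c" x] x by (auto simp: mult[symmetric])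
  qed
  have "covers H (f ` S) (f x) = (`) f ` covers G S x"
  proof (intro equalityI subsetI)
    fix K assume "K \<in> covers H (f ` S) (f x)"
    then obtain a b c where abc: "a \<in> S" "b \<in> S" "c \<in> S" "K = {f a, f b, f c}"
      "f a \<otimes>\<^bsub>H\<^esub> f b \<otimes>\<^bsub>H\<^esub> f c = f x"
      unfolding covers_def by blast
    then have "{a, b, c} \<in> covers G S x"
      unfolding covers_def using sum_eq by blast
    moreover have "K = f ` {a, b, c}"
      using abc by simp
    ultimately show "K \<in> (`) f ` covers G S x"
      by blast
  next
    fix K assume "K \<in> (`) f ` covers G S x"
    then obtain a b c where abc: "a \<in> S" "b \<in> S" "c \<in> S" "K = f ` {a, b, c}"
      "a \<otimes>\<^bsub>G\<^esub> b \<otimes>\<^bsub>G\<^esub> c = x"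
      unfolding covers_def by blast
    then have "K = {f a, f b, f c}" "f a \<otimes>\<^bsub>H\<^esub> f b \<otimes>\<^bsub>H\<^esub> f c = f x"
      using sum_eq by auto
    then show "K \<in> covers H (f ` S) (f x)"
      unfolding covers_def using abc by blast
  qed
  moreover have "inj_on ((`) f) (covers G S x)"
  proof (rule inj_on_subset[OF inj_on_image_Pow[OF inj]])
    show "covers G S x \<subseteq> Pow (carrier G)"
      using S unfolding covers_def by auto
  qed
  ultimately show ?thesis
    by (simp add: card_image)
qed

section \<open>Arithmetic in finite fields of characteristic 2\<close>

locale finite_char2_field = field R for R (structure) +
  assumes finite_carrier: "finite (carrier R)"
    and one_add_one: "\<one> \<oplus> \<one> = \<zero>"
begin

lemma add_self: "x \<in> carrier R \<Longrightarrow> x \<oplus> x = \<zero>"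
  using one_add_one l_distr[of \<one> \<one> x] by simp

lemma add_self_left: "x \<in> carrier R \<Longrightarrow> y \<in> carrier R \<Longrightarrow> x \<oplus> (x \<oplus> y) = y"
  by (simp add: a_assoc[symmetric] add_self)

lemmas char2_simps = a_ac m_ac l_distr r_distr add_self add_self_left

lemma add_eq_zero_iff: "x \<in> carrier R \<Longrightarrow> y \<in> carrier R \<Longrightarrow> x \<oplus> y = \<zero> \<longleftrightarrow> x = y"
  using add_self add_self_left[of x y] by auto

lemma cube_eq: "x \<in> carrier R \<Longrightarrow> x [^] (3::nat) = x \<otimes> (x \<otimes> x)"
  by (simp add: numeral_3_eq_3 m_ac)

lemma bij_betw_translation:
  assumes "a \<in> carrier R"
  shows "bij_betw ((\<oplus>) a) (carrier R) (carrier R)"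
  using assms by (intro bij_betw_byWitness[where f' = "(\<oplus>) a"]) (auto simp: add_self_left)

lemma bij_betw_mult:
  assumes "a \<in> carrier R" "a \<noteq> \<zero>"
  shows "bij_betw ((\<otimes>) a) (carrier R) (carrier R)"
proof -
  have a: "a \<in> Units R" using assms by (simp add: field_Units)
  then show ?thesis using assms
    by (intro bij_betw_byWitness[where f' = "(\<otimes>) (inv a)"]) (auto simp: m_assoc[symmetric])
qed

text \<open>Squaring is injective, since equal squares give \<open>(x + y)^2 = 0\<close>; on a
  finite carrier it is therefore surjective.\<close>

lemma square_surj:
  assumes "a \<in> carrier R"
  obtains s where "s \<in> carrier R" "s \<otimes> s = a"
proof -
  have "inj_on (\<lambda>s. s \<otimes> s) (carrier R)"
  proof (rule inj_onI)
    fix x y assume xy: "x \<in> carrier R" "y \<in> carrier R" "x \<otimes> x = y \<otimes> y"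
    then have "(x \<oplus> y) \<otimes> (x \<oplus> y) = \<zero>"
      by (simp add: char2_simps)
    then show "x = y"
      using xy integral[of "x \<oplus> y" "x \<oplus> y"] by (auto simp: add_eq_zero_iff)
  qed
  then have "(\<lambda>s. s \<otimes> s) ` carrier R = carrier R"
    by (intro endo_inj_surj finite_carrier) auto
  then show ?thesis
    using assms that by force
qed

section \<open>The Artin-Schreier image and its index\<close>

definition AS :: "'a set" where
  "AS = (\<lambda>z. z \<otimes> z \<oplus> z) ` carrier R"

lemma AS_subset: "AS \<subseteq> carrier R"
  by (auto simp: AS_def)

lemma finite_AS: "finite AS"
  using AS_subset finite_carrier finite_subset by blast

lemma AS_add: "a \<in> AS \<Longrightarrow> b \<in> AS \<Longrightarrow> a \<oplus> b \<in> AS"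
proof -
  assume "a \<in> AS" "b \<in> AS"
  then obtain x y where "x \<in> carrier R" "y \<in> carrier R" "a = x \<otimes> x \<oplus> x" "b = y \<otimes> y \<oplus> y"
    by (auto simp: AS_def)
  then have "a \<oplus> b = (x \<oplus> y) \<otimes> (x \<oplus> y) \<oplus> (x \<oplus> y)" "x \<oplus> y \<in> carrier R"
    by (simp_all add: char2_simps)
  then show ?thesis
    unfolding AS_def by blast
qed

text \<open>Two solutions differ by a root of \<open>X^2 + X = X (X + 1)\<close>, so the fibre
  through \<open>z\<close> is \<open>{z, z + 1}\<close>.\<close>

lemma card_AS_fibre:
  assumes "a \<in> AS"
  shows "card {z \<in> carrier R. z \<otimes> z \<oplus> z = a} = 2"
proof -
  from assms obtain z where z: "z \<in> carrier R" "a = z \<otimes> z \<oplus> z"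
    by (auto simp: AS_def)
  have "y \<otimes> y \<oplus> y = a \<longleftrightarrow> y = z \<or> y = z \<oplus> \<one>" if y: "y \<in> carrier R" for y
  proof -
    have "y \<otimes> y \<oplus> y = a \<longleftrightarrow> (y \<oplus> z) \<otimes> (y \<oplus> (z \<oplus> \<one>)) = \<zero>"
    proof -
      have "(y \<oplus> z) \<otimes> (y \<oplus> (z \<oplus> \<one>)) = (y \<otimes> y \<oplus> y) \<oplus> a"
        using y z by (simp add: char2_simps)
      then show ?thesis
        using y z by (simp add: add_eq_zero_iff)
    qed
    also have "\<dots> \<longleftrightarrow> y = z \<or> y = z \<oplus> \<one>"
      using y z integral_iff[of "y \<oplus> z" "y \<oplus> (z \<oplus> \<one>)"] by (simp add: add_eq_zero_iff)
    finally show ?thesis .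
  qed
  then have "{y \<in> carrier R. y \<otimes> y \<oplus> y = a} = {z, z \<oplus> \<one>}"
    using z by auto
  moreover have "z \<noteq> z \<oplus> \<one>"
  proof
    assume "z = z \<oplus> \<one>"
    then have "z \<oplus> z = z \<oplus> (z \<oplus> \<one>)" by simp
    then show False
      using z by (simp add: add_self add_self_left)
  qed
  ultimately show ?thesis
    by simp
qed

lemma card_AS: "2 * card AS = card (carrier R)"
proof -
  have "card (carrier R) = card (\<Union>a\<in>AS. {z \<in> carrier R. z \<otimes> z \<oplus> z = a})"
    by (rule arg_cong[where f = card]) (auto simp: AS_def)
  also have "\<dots> = (\<Sum>a\<in>AS. card {z \<in> carrier R. z \<otimes> z \<oplus> z = a})"
    by (rule card_UN_disjoint) (use finite_AS finite_carrier in auto)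
  also have "\<dots> = (\<Sum>a\<in>AS. 2)"
    by (rule sum.cong) (simp_all add: card_AS_fibre)
  finally show ?thesis
    by simp
qed

text \<open>\<open>AS\<close> and its translate by \<open>a\<close> are disjoint and each contains
  half of the field, so together they exhaust it. Hence \<open>b = a + h\<close> with
  \<open>h\<close> in \<open>AS\<close>, and \<open>a + b = h\<close>.\<close>

lemma AS_add_nonmembers:
  assumes a: "a \<in> carrier R" "a \<notin> AS" and b: "b \<in> carrier R" "b \<notin> AS"
  shows "a \<oplus> b \<in> AS"
proof -
  have inj: "inj_on ((\<oplus>) a) AS"
    using bij_betw_translation[OF a(1)] AS_subset by (meson bij_betw_imp_inj_on inj_on_subset)
  have disj: "AS \<inter> (\<oplus>) a ` AS = {}"
  proof -
    have False if "h \<in> AS" "a \<oplus> h \<in> AS" for h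
    proof -
      have "h \<oplus> (a \<oplus> h) = a"
        using that a AS_subset by (simp add: subset_iff char2_simps)
      then show False
        using AS_add[OF that] a by simp
    qed
    then show ?thesis by blast
  qed
  have "card (AS \<union> (\<oplus>) a ` AS) = card (carrier R)"
    using card_AS by (simp add: card_Un_disjoint finite_AS disj card_image[OF inj])
  moreover have "AS \<union> (\<oplus>) a ` AS \<subseteq> carrier R"
    using AS_subset a by auto
  ultimately have "AS \<union> (\<oplus>) a ` AS = carrier R"
    using finite_carrier card_subset_eq by blast
  then obtain h where "h \<in> AS" "b = a \<oplus> h"
    using b by blast
  then show ?thesis
    using a AS_subset by (auto simp: add_self_left)
qed

section \<open>The quadratic additive character\<close>

text \<open>On the carrier this is \<open>(-1)^Tr(z)\<close> for the absolute trace
  \<open>Tr\<close>, whose kernel is \<open>AS\<close>.\<close>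

definition \<chi> :: "'a \<Rightarrow> real" where
  "\<chi> z = (if z \<in> AS then 1 else - 1)"

lemma abs_chi: "\<bar>\<chi> z\<bar> = 1"
  by (simp add: \<chi>_def)

lemma chi_add:
  assumes "a \<in> carrier R" "b \<in> carrier R"
  shows "\<chi> (a \<oplus> b) = \<chi> a * \<chi> b"
proof -
  have "a \<oplus> b \<notin> AS" if "a \<in> AS" "b \<notin> AS"
    using AS_add[of a "a \<oplus> b"] that assms by (auto simp: add_self_left)
  moreover have "a \<oplus> b \<notin> AS" if "a \<notin> AS" "b \<in> AS"
    using AS_add[of b "a \<oplus> b"] that assms by (auto simp: a_comm[of a b] add_self_left)
  ultimately show ?thesis
    using AS_add AS_add_nonmembers assms by (auto simp: \<chi>_def)
qed

text \<open>\<open>a^2 + a\<close> lies in \<open>AS\<close>, so the values at \<open>a^2\<close>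
  and \<open>a\<close> have product 1; both are signs, so they agree.\<close>

lemma chi_square:
  assumes "a \<in> carrier R"
  shows "\<chi> (a \<otimes> a) = \<chi> a"
proof -
  have "\<chi> (a \<otimes> a \<oplus> a) = 1"
    using assms by (auto simp: \<chi>_def AS_def)
  then show ?thesis
    using assms by (auto simp: chi_add) (auto simp: \<chi>_def split: if_splits)
qed

lemma sum_chi: "(\<Sum>z\<in>carrier R. \<chi> z) = 0"
proof -
  have "(\<Sum>z\<in>carrier R. \<chi> z) = (\<Sum>z\<in>carrier R - AS. \<chi> z) + (\<Sum>z\<in>AS. \<chi> z)"
    by (rule sum.subset_diff[OF AS_subset finite_carrier])
  also have "\<dots> = - real (card (carrier R - AS)) + real (card AS)"
    by (simp add: \<chi>_def)
  also have "card (carrier R - AS) = card AS"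
    using card_AS by (simp add: card_Diff_subset AS_subset finite_AS)
  finally show ?thesis
    by simp
qed

lemma sum_chi_mult:
  assumes "a \<in> carrier R" "a \<noteq> \<zero>"
  shows "(\<Sum>z\<in>carrier R. \<chi> (a \<otimes> z)) = 0"
  using sum.reindex_bij_betw[OF bij_betw_mult[OF assms], of \<chi>] by (simp add: sum_chi)

section \<open>The cubic character sum\<close>

text \<open>Writing \<open>t h = s^2\<close> makes the quadratic term the square
  \<open>(s w)^2\<close>, which \<open>\<chi>\<close> does not distinguish from \<open>s w\<close>.
  The argument becomes linear in \<open>w\<close> with coefficient \<open>s + t h^2\<close>. This is
  nonzero, since \<open>s = t h^2\<close> would square to the excluded equation.\<close>

lemma sum_chi_derivative:
  assumes t: "t \<in> carrier R" and h: "h \<in> carrier R"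
    and "t \<otimes> h \<noteq> (t \<otimes> (h \<otimes> h)) \<otimes> (t \<otimes> (h \<otimes> h))"
  shows "(\<Sum>w\<in>carrier R. \<chi> (t \<otimes> h \<otimes> (w \<otimes> w) \<oplus> t \<otimes> (h \<otimes> h) \<otimes> w)) = 0"
proof -
  obtain s where s: "s \<in> carrier R" "s \<otimes> s = t \<otimes> h"
    using square_surj[OF m_closed[OF t h]] by blast
  have "\<chi> (t \<otimes> h \<otimes> (w \<otimes> w) \<oplus> t \<otimes> (h \<otimes> h) \<otimes> w) = \<chi> ((s \<oplus> t \<otimes> (h \<otimes> h)) \<otimes> w)"
    if w: "w \<in> carrier R" for w
  proof -
    have "t \<otimes> h \<otimes> (w \<otimes> w) = (s \<otimes> w) \<otimes> (s \<otimes> w)"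
      using s(1) w by (simp add: s(2)[symmetric] m_ac)
    then show ?thesis
      using s(1) t h w by (simp add: chi_add chi_square l_distr)
  qed
  then have "(\<Sum>w\<in>carrier R. \<chi> (t \<otimes> h \<otimes> (w \<otimes> w) \<oplus> t \<otimes> (h \<otimes> h) \<otimes> w))
      = (\<Sum>w\<in>carrier R. \<chi> ((s \<oplus> t \<otimes> (h \<otimes> h)) \<otimes> w))"
    by (rule sum.cong[OF refl])
  also have "\<dots> = 0"
    using s t h assms(3) by (intro sum_chi_mult) (auto simp: add_eq_zero_iff)
  finally show ?thesis .
qed

text \<open>For \<open>h\<close> nonzero the equation cancels to \<open>t h^3 = 1\<close>. Any two
  such \<open>h\<close> thus differ by a factor that is a cube root of unity, of which there are at
  most three; \<open>h = 0\<close> is the fourth possibility.\<close>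

lemma card_degenerate_directions:
  assumes t: "t \<in> carrier R" "t \<noteq> \<zero>"
  shows "card {h \<in> carrier R. t \<otimes> h = (t \<otimes> (h \<otimes> h)) \<otimes> (t \<otimes> (h \<otimes> h))} \<le> 4"
    (is "card ?B \<le> 4")
proof -
  have cube: "t \<otimes> (h \<otimes> (h \<otimes> h)) = \<one>" if h: "h \<in> ?B" "h \<noteq> \<zero>" for h
  proof -
    have hc: "h \<in> carrier R" using h by simp
    have "(t \<otimes> h) \<otimes> (t \<otimes> (h \<otimes> (h \<otimes> h))) = (t \<otimes> (h \<otimes> h)) \<otimes> (t \<otimes> (h \<otimes> h))"
      using t hc by (simp add: m_ac)
    also have "\<dots> = (t \<otimes> h) \<otimes> \<one>"
      using h t hc by simp
    finally have "(t \<otimes> h) \<otimes> (t \<otimes> (h \<otimes> (h \<otimes> h))) = (t \<otimes> h) \<otimes> \<one>" .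
    moreover have "t \<otimes> h \<noteq> \<zero>"
      using t hc h integral by blast
    ultimately show ?thesis
      using m_lcancel t hc by (meson m_closed one_closed)
  qed
  show ?thesis
  proof (cases "?B \<subseteq> {\<zero>}")
    case True
    then show ?thesis
      using card_mono[OF _ True] by simp
  next
    case False
    then obtain g where g: "g \<in> ?B" "g \<noteq> \<zero>" by blast
    then have gU: "g \<in> carrier R" "g \<in> Units R" by (auto simp: field_Units)
    let ?U = "{x \<in> carrier R. x [^] (3::nat) = \<one>}"
    have "?B - {\<zero>} \<subseteq> (\<otimes>) g ` ?U"
    proof
      fix h assume "h \<in> ?B - {\<zero>}"
      then have h: "h \<in> ?B" "h \<noteq> \<zero>" "h \<in> carrier R" by auto
      let ?k = "inv g"
      have k: "?k \<in> carrier R" "g \<otimes> ?k = \<one>" "?k \<otimes> g = \<one>" using gU by auto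
      have hg: "h \<otimes> (h \<otimes> h) = g \<otimes> (g \<otimes> g)"
        using cube[OF h(1,2)] cube[OF g] t gU(1) h(3) m_lcancel by (metis m_closed)
      have "(?k \<otimes> h) [^] (3::nat) = (?k \<otimes> (?k \<otimes> ?k)) \<otimes> (h \<otimes> (h \<otimes> h))"
        using k h by (simp add: cube_eq m_ac)
      also have "\<dots> = (?k \<otimes> g) \<otimes> ((?k \<otimes> g) \<otimes> (?k \<otimes> g))"
        unfolding hg using k(1) gU(1) by (simp add: m_ac)
      finally have "?k \<otimes> h \<in> ?U"
        using k h by simp
      moreover have "h = g \<otimes> (?k \<otimes> h)"
        using k h gU by (simp add: m_assoc[symmetric])
      ultimately show "h \<in> (\<otimes>) g ` ?U" by blast
    qed
    then have "card (?B - {\<zero>}) \<le> card ?U"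
      by (rule surj_card_le[rotated]) (use finite_carrier in simp)
    also have "\<dots> \<le> 3"
      using num_roots_le_deg[OF finite_carrier, of 3] by simp
    finally have "card (?B - {\<zero>}) \<le> 3" .
    moreover have "card ?B \<le> Suc (card (?B - {\<zero>}))"
      using diff_card_le_card_Diff[of "{\<zero>}" ?B] by simp
    ultimately show ?thesis
      by linarith
  qed
qed

text \<open>Weyl differencing: the square is a double sum over \<open>w\<close> and
  \<open>v = w + h\<close>. For fixed \<open>h\<close> the sum over \<open>w\<close> vanishes except
  for at most four \<open>h\<close>, each contributing at most the order of the field.\<close>

lemma cubic_sum_square_le:
  assumes t: "t \<in> carrier R" "t \<noteq> \<zero>"
  shows "(\<Sum>w\<in>carrier R. \<chi> (t \<otimes> (w \<otimes> (w \<otimes> w))))\<^sup>2 \<le> 4 * real (card (carrier R))"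
proof -
  let ?C = "carrier R"
  let ?f = "\<lambda>w. \<chi> (t \<otimes> (w \<otimes> (w \<otimes> w)))"
  let ?d = "\<lambda>h w. \<chi> (t \<otimes> h \<otimes> (w \<otimes> w) \<oplus> t \<otimes> (h \<otimes> h) \<otimes> w)"
  let ?B = "{h \<in> carrier R. t \<otimes> h = (t \<otimes> (h \<otimes> h)) \<otimes> (t \<otimes> (h \<otimes> h))}"
  have step: "?f w * ?f (w \<oplus> h) = ?f h * ?d h w" if "w \<in> ?C" "h \<in> ?C" for w h
  proof -
    have "?f w * ?f (w \<oplus> h)
        = \<chi> (t \<otimes> (w \<otimes> (w \<otimes> w)) \<oplus> t \<otimes> ((w \<oplus> h) \<otimes> ((w \<oplus> h) \<otimes> (w \<oplus> h))))"
      using t that by (simp add: chi_add)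
    \<comment> \<open>The two terms \<open>t w^3\<close> cancel and the binomial coefficients 3
      equal 1, leaving degree 2 in \<open>w\<close>.\<close>
    also have "t \<otimes> (w \<otimes> (w \<otimes> w)) \<oplus> t \<otimes> ((w \<oplus> h) \<otimes> ((w \<oplus> h) \<otimes> (w \<oplus> h)))
        = t \<otimes> (h \<otimes> (h \<otimes> h)) \<oplus> (t \<otimes> h \<otimes> (w \<otimes> w) \<oplus> t \<otimes> (h \<otimes> h) \<otimes> w)"
      using t that by (simp add: char2_simps)
    also have "\<chi> \<dots> = ?f h * ?d h w"
      using t that by (intro chi_add) auto
    finally show ?thesis .
  qed
  have "(\<Sum>w\<in>?C. ?f w)\<^sup>2 = (\<Sum>w\<in>?C. \<Sum>v\<in>?C. ?f w * ?f v)"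
    by (simp add: power2_eq_square sum_product)
  also have "\<dots> = (\<Sum>w\<in>?C. \<Sum>h\<in>?C. ?f w * ?f (w \<oplus> h))"
  proof (rule sum.cong[OF refl])
    fix w assume "w \<in> ?C"
    from sum.reindex_bij_betw[OF bij_betw_translation[OF this], of "\<lambda>v. ?f w * ?f v"]
    show "(\<Sum>v\<in>?C. ?f w * ?f v) = (\<Sum>h\<in>?C. ?f w * ?f (w \<oplus> h))" by simp
  qed
  also have "\<dots> = (\<Sum>w\<in>?C. \<Sum>h\<in>?C. ?f h * ?d h w)"
    by (intro sum.cong refl step)
  also have "\<dots> = (\<Sum>h\<in>?C. ?f h * (\<Sum>w\<in>?C. ?d h w))"
    by (subst sum.swap) (simp add: sum_distrib_left)
  also have "\<dots> = (\<Sum>h\<in>?B. ?f h * (\<Sum>w\<in>?C. ?d h w))"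
    using t by (intro sum.mono_neutral_right finite_carrier) (auto simp: sum_chi_derivative)
  also have "\<dots> \<le> (\<Sum>h\<in>?B. real (card ?C))"
  proof (rule sum_mono)
    fix h
    have "?f h * (\<Sum>w\<in>?C. ?d h w) \<le> \<bar>?f h * (\<Sum>w\<in>?C. ?d h w)\<bar>"
      by (rule abs_ge_self)
    also have "\<dots> = \<bar>\<Sum>w\<in>?C. ?d h w\<bar>"
      by (simp add: abs_mult abs_chi)
    also have "\<dots> \<le> (\<Sum>w\<in>?C. \<bar>?d h w\<bar>)"
      by (rule sum_abs)
    also have "\<dots> = real (card ?C)"
      by (simp add: abs_chi)
    finally show "?f h * (\<Sum>w\<in>?C. ?d h w) \<le> real (card ?C)" .
  qed
  also have "\<dots> \<le> 4 * real (card ?C)"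
    using card_degenerate_directions[OF t] by (simp add: mult_right_mono)
  finally show ?thesis .
qed

section \<open>Counting points on the Artin-Schreier curve\<close>

text \<open>\<open>w = 0\<close> is left out because a point is turned into a cover through
  \<open>v = 1/w\<close>.\<close>

definition cubic_points :: "'a \<Rightarrow> ('a \<times> 'a) set" where
  "cubic_points t = {(w, z). w \<in> carrier R \<and> z \<in> carrier R \<and> w \<noteq> \<zero> \<and>
     z \<otimes> z \<oplus> z = t \<otimes> (w \<otimes> (w \<otimes> w))}"

text \<open>The character sum determines how many \<open>w\<close> make \<open>t w^3\<close> an
  Artin-Schreier value; each such \<open>w\<close> other than 0 carries exactly two
  \<open>z\<close>.\<close>

lemma card_cubic_points_ge:
  assumes t: "t \<in> carrier R" "t \<noteq> \<zero>" and q: "card (carrier R) \<ge> 64"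
  shows "real (card (carrier R)) / 2 \<le> real (card (cubic_points t))"
proof -
  let ?q = "real (card (carrier R))"
  let ?g = "\<lambda>w. t \<otimes> (w \<otimes> (w \<otimes> w))"
  let ?W = "{w \<in> carrier R. ?g w \<in> AS}"
  let ?S = "\<Sum>w\<in>carrier R. \<chi> (?g w)"
  have finW: "finite ?W" using finite_carrier by simp
  have "?S = (\<Sum>w\<in>carrier R. 2 * of_bool (?g w \<in> AS) - 1)"
    by (rule sum.cong) (auto simp: \<chi>_def)
  also have "\<dots> = 2 * real (card ?W) - ?q"
    using finite_carrier by (simp add: sum_subtractf sum_distrib_left[symmetric] sum_of_bool_eq Int_def)
  finally have W: "2 * real (card ?W) = ?q + ?S" by simp
  have "?S\<^sup>2 \<le> 4 * ?q" by (rule cubic_sum_square_le[OF t])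
  \<comment> \<open>\<open>4 q \<le> q^2 / 16\<close> is precisely \<open>q \<ge> 64\<close>, the
    origin of that bound.\<close>
  also have "\<dots> \<le> (?q / 4)\<^sup>2"
    using q by (simp add: power2_eq_square field_simps)
  finally have "\<bar>?S\<bar> \<le> ?q / 4"
    using abs_le_square_iff[of ?S "?q / 4"] by simp
  then have "- (?q / 4) \<le> ?S"
    by (simp add: abs_le_iff)
  moreover have "64 \<le> ?q"
    using q by simp
  \<comment> \<open>The right side is \<open>q + S - 2\<close>, at least \<open>3 q / 4 - 2\<close>;
    the \<open>- 1\<close> pays for removing \<open>w = 0\<close>.\<close>
  ultimately have "?q / 2 \<le> 2 * (real (card ?W) - 1)"
    using W by argo
  also have "real (card ?W) - 1 \<le> real (card (?W - {\<zero>}))"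
    using diff_card_le_card_Diff[of "{\<zero>}" ?W] by simp
  also have "2 * real (card (?W - {\<zero>})) = real (card (cubic_points t))"
  proof -
    have "cubic_points t = (SIGMA w:?W - {\<zero>}. {z \<in> carrier R. z \<otimes> z \<oplus> z = ?g w})"
      by (auto simp: cubic_points_def AS_def intro: rev_image_eqI)
    then have "card (cubic_points t) = (\<Sum>w\<in>?W - {\<zero>}. card {z \<in> carrier R. z \<otimes> z \<oplus> z = ?g w})"
      using finW finite_carrier by (simp add: card_SigmaI)
    also have "\<dots> = (\<Sum>w\<in>?W - {\<zero>}. 2)"
      by (rule sum.cong) (auto simp: card_AS_fibre)
    finally show ?thesis by simp
  qed
  finally show ?thesis by simp
qed

section \<open>From curve points to covers\<close>

text \<open>Each point of the curve yields a cover by the graph points over \<open>x + v\<close>,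
  \<open>x + u + v\<close> and \<open>x + u\<close>. The factor 18 is 2 from the point count times 9
  for the points that may share a cover.\<close>

lemma card_covers_cube_graph_ge:
  assumes x: "x \<in> carrier R" and y: "y \<in> carrier R" and xy: "y \<noteq> x [^] (3::nat)"
    and q: "card (carrier R) \<ge> 64"
  shows "real (card (carrier R)) / 18
    \<le> real (card (covers (add_monoid R \<times>\<times> add_monoid R) (cube_graph R) (x, y)))"
proof -
  let ?cov = "covers (add_monoid R \<times>\<times> add_monoid R) (cube_graph R) (x, y)"
  define t where "t = x [^] (3::nat) \<oplus> y"
  have t: "t \<in> carrier R" "t \<noteq> \<zero>"
    using x y xy by (auto simp: t_def add_eq_zero_iff)
  define p where "p = (\<lambda>v. (v, v [^] (3::nat)))"
  have p: "p v \<in> cube_graph R" if "v \<in> carrier R" for v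
    using that by (auto simp: p_def cube_graph_def)
  \<comment> \<open>The pair holds the graph points over \<open>x + v\<close> and
    \<open>x + u\<close>; their first coordinates already give back \<open>w\<close> and
    \<open>z\<close>.\<close>
  define g where "g = (\<lambda>(w, z). (p (x \<oplus> inv w), p (x \<oplus> z \<otimes> inv w)))"
  have inj: "inj_on g (cubic_points t)"
  proof (rule inj_onI, clarify)
    fix w z w' z' assume w: "(w, z) \<in> cubic_points t" and w': "(w', z') \<in> cubic_points t"
      and eq: "g (w, z) = g (w', z')"
    have wU: "w \<in> Units R" "w \<in> carrier R" "z \<in> carrier R"
      and wU': "w' \<in> Units R" "z' \<in> carrier R"
      using w w' by (auto simp: cubic_points_def field_Units)
    have "inv w = inv w'"
      using eq x wU wU' by (auto simp: g_def p_def)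
    then have ww: "w = w'"
      using wU wU' Units_inv_inv by metis
    have "z \<otimes> inv w = z' \<otimes> inv w"
      using eq x wU wU' ww by (auto simp: g_def p_def)
    then have "z \<otimes> inv w \<otimes> w = z' \<otimes> inv w \<otimes> w" by simp
    then have "z = z'"
      using wU wU' by (simp add: m_assoc)
    with ww show "w = w' \<and> z = z'" by simp
  qed
  have range: "g ` cubic_points t \<subseteq> (\<Union>K\<in>?cov. K \<times> K)"
  proof (rule image_subsetI)
    fix s assume "s \<in> cubic_points t"
    then obtain w z where s: "s = (w, z)" and w: "(w, z) \<in> cubic_points t"
      by (cases s) auto
    define v where "v = inv w"
    define u where "u = z \<otimes> v"
    have wz: "w \<in> Units R" "w \<in> carrier R" "z \<in> carrier R"
      "z \<otimes> z \<oplus> z = t \<otimes> (w \<otimes> (w \<otimes> w))"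
      using w by (auto simp: cubic_points_def field_Units)
    have vc: "v \<in> carrier R" "v \<otimes> w = \<one>" and uc: "u \<in> carrier R"
      using wz by (auto simp: v_def u_def)
    have "u \<otimes> (v \<otimes> (u \<oplus> v)) = (z \<otimes> z \<oplus> z) \<otimes> (v \<otimes> (v \<otimes> v))"
      using wz(3) vc(1) by (simp add: u_def char2_simps)
    also have "\<dots> = t \<otimes> ((v \<otimes> w) \<otimes> ((v \<otimes> w) \<otimes> (v \<otimes> w)))"
      unfolding wz(4) using t(1) wz(2) vc(1) by (simp add: m_ac)
    finally have uv: "u \<otimes> (v \<otimes> (u \<oplus> v)) = t"
      using vc t by simp
    \<comment> \<open>This is the three-term cube identity: the bases sum to \<open>x\<close>, and
      their pairwise sums are \<open>u\<close>, \<open>v\<close> and \<open>u + v\<close>.\<close>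
    have "(x \<oplus> v) [^] (3::nat) \<oplus> (x \<oplus> u \<oplus> v) [^] (3::nat) \<oplus> (x \<oplus> u) [^] (3::nat)
        = x [^] (3::nat) \<oplus> u \<otimes> (v \<otimes> (u \<oplus> v))"
      using x vc(1) uc by (simp add: cube_eq char2_simps)
    also have "\<dots> = y"
      unfolding uv using x y by (simp add: t_def add_self_left)
    finally have cubes: "(x \<oplus> v) [^] (3::nat) \<oplus> (x \<oplus> u \<oplus> v) [^] (3::nat) \<oplus> (x \<oplus> u) [^] (3::nat) = y" .
    have "x \<oplus> v \<oplus> (x \<oplus> u \<oplus> v) \<oplus> (x \<oplus> u) = x"
      using x vc(1) uc by (simp add: char2_simps)
    with cubes have "p (x \<oplus> v) \<otimes>\<^bsub>add_monoid R \<times>\<times> add_monoid R\<^esub> p (x \<oplus> u \<oplus> v)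
        \<otimes>\<^bsub>add_monoid R \<times>\<times> add_monoid R\<^esub> p (x \<oplus> u) = (x, y)"
      by (simp add: p_def)
    moreover have "p (x \<oplus> v) \<in> cube_graph R" "p (x \<oplus> u \<oplus> v) \<in> cube_graph R"
      "p (x \<oplus> u) \<in> cube_graph R"
      using x vc(1) uc by (auto intro: p)
    ultimately have "{p (x \<oplus> v), p (x \<oplus> u \<oplus> v), p (x \<oplus> u)} \<in> ?cov"
      unfolding covers_def by blast
    moreover have "g s = (p (x \<oplus> v), p (x \<oplus> u))"
      by (simp add: g_def u_def v_def s)
    ultimately show "g s \<in> (\<Union>K\<in>?cov. K \<times> K)"
      by (intro UN_I) auto
  qed
  \<comment> \<open>An infinite family would have \<open>card\<close> 0, which would defeat a lower
    bound.\<close>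
  have fin: "finite ?cov"
  proof (rule finite_subset)
    show "?cov \<subseteq> Pow (cube_graph R)" by (auto simp: covers_def)
    have "cube_graph R = p ` carrier R" by (auto simp: cube_graph_def p_def)
    then show "finite (Pow (cube_graph R))" using finite_carrier by simp
  qed
  \<comment> \<open>A solution \<open>(w, z)\<close> is recovered from an ordered pair of elements of the cover it yields, so
    at most \<open>3\<^sup>2 = 9\<close> solutions share a cover.\<close>
  have small: "finite K \<and> card K \<le> 3" if "K \<in> ?cov" for K
    using that by (auto simp: covers_def card_insert_if)
  have "card (cubic_points t) = card (g ` cubic_points t)"
    by (simp add: card_image inj)
  also have "\<dots> \<le> card (\<Union>K\<in>?cov. K \<times> K)"
    using fin small by (intro card_mono range) auto
  also have "\<dots> \<le> (\<Sum>K\<in>?cov. card (K \<times> K))"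
    by (rule card_UN_le[OF fin])
  also have "\<dots> \<le> (\<Sum>K\<in>?cov. 9)"
  proof (rule sum_mono)
    fix K assume "K \<in> ?cov"
    then have "card K * card K \<le> 3 * 3"
      using small by (intro mult_le_mono) auto
    then show "card (K \<times> K) \<le> 9" by (simp add: card_cartesian_product)
  qed
  finally have "real (card (cubic_points t)) \<le> 9 * real (card ?cov)"
    by simp
  with card_cubic_points_ge[OF t q] show ?thesis by linarith
qed

end

section \<open>Fields of order \<open>2 ^ n\<close> and the final bound\<close>

text \<open>By Lagrange in the additive group, \<open>2 ^ n\<close> times \<open>\<one>\<close> is
  zero. This multiple is the \<open>n\<close>-th power of \<open>\<one> \<oplus> \<one>\<close>,
  which could not vanish in a field if \<open>\<one> \<oplus> \<one>\<close> were nonzero.\<close>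

lemma (in field) one_add_one_of_card_power_two:
  assumes card: "card (carrier R) = 2 ^ n"
  shows "\<one> \<oplus> \<one> = \<zero>"
proof (rule ccontr)
  assume two: "\<one> \<oplus> \<one> \<noteq> \<zero>"
  have "[(2 ^ k :: nat)] \<cdot> \<one> \<noteq> \<zero>" for k
  proof (induction k)
    case (Suc k)
    let ?a = "[(2 ^ k :: nat)] \<cdot> \<one>"
    have "[(2 ^ Suc k :: nat)] \<cdot> \<one> = ?a \<oplus> ?a"
      using add.nat_pow_mult[of \<one> "2 ^ k" "2 ^ k"] by (simp add: mult_2)
    also have "\<dots> = (\<one> \<oplus> \<one>) \<otimes> ?a"
      by (simp add: l_distr)
    finally show ?case
      using two Suc.IH integral[of "\<one> \<oplus> \<one>" ?a] by auto
  qed simp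
  moreover have "[(2 ^ n :: nat)] \<cdot> \<one> = \<zero>"
    using add.pow_order_eq_1[of \<one>] card by (simp add: order_def)
  ultimately show False by blast
qed

theorem theorem2p3:
  shows "\<exists>c::real. c > 0 \<and> (\<exists>n\<^sub>0::nat. \<forall>n>n\<^sub>0. \<forall>F :: 'a ring.
    field F \<and> card (carrier F) = 2 ^ n \<longrightarrow>
      (\<forall>x\<in>carrier F. \<forall>y\<in>carrier F. y \<noteq> x [^]\<^bsub>F\<^esub> (3::nat) \<longrightarrow>
         c * 2 ^ n \<le> real (card (covers (add_monoid F \<times>\<times> add_monoid F) (cube_graph F) (x, y))))
    \<and> (\<forall>\<phi> \<in> iso (add_monoid F \<times>\<times> add_monoid F) (Z2_power (2 * n)).
         \<forall>z \<in> carrier (Z2_power (2 * n)) - \<phi> ` cube_graph F.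
           c * 2 ^ n \<le> real (card (covers (Z2_power (2 * n)) (\<phi> ` cube_graph F) z))))"
proof (intro exI[of _ "1 / 18"] exI[of _ 5] conjI allI impI ballI)
  fix n :: nat and F :: "'a ring" and x y
  assume n: "n > 5" and F: "field F \<and> card (carrier F) = 2 ^ n"
    and xy: "x \<in> carrier F" "y \<in> carrier F" "y \<noteq> x [^]\<^bsub>F\<^esub> (3::nat)"
  interpret field F using F by simp
  \<comment> \<open>Finiteness follows from the cardinality alone, since an infinite carrier has
    \<open>card\<close> 0 rather than \<open>2 ^ n\<close>.\<close>
  interpret finite_char2_field F
    using F one_add_one_of_card_power_two[of n] card_ge_0_finite[of "carrier F"]
    by unfold_locales auto
  \<comment> \<open>The threshold 5 for \<open>n\<close> is chosen so that the order is at least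
    \<open>2 ^ 6 = 64\<close>.\<close>
  have "(2::nat) ^ 6 \<le> 2 ^ n" using n by (intro power_increasing) auto
  then show "1 / 18 * 2 ^ n \<le> real (card (covers (add_monoid F \<times>\<times> add_monoid F) (cube_graph F) (x, y)))"
    using card_covers_cube_graph_ge[OF xy] F by simp
next
  fix n :: nat and F :: "'a ring" and \<phi> z
  let ?G = "add_monoid F \<times>\<times> add_monoid F"
  assume n: "n > 5" and F: "field F \<and> card (carrier F) = 2 ^ n"
    and \<phi>: "\<phi> \<in> iso ?G (Z2_power (2 * n))"
    and z: "z \<in> carrier (Z2_power (2 * n)) - \<phi> ` cube_graph F"
  interpret field F using F by simp
  interpret finite_char2_field F
    using F one_add_one_of_card_power_two[of n] card_ge_0_finite[of "carrier F"]
    by unfold_locales auto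
  \<comment> \<open>Pull \<open>z\<close> back to a pair \<open>(x, y)\<close>; it lies off the cube
    graph because \<open>z\<close> lies off the image of that graph.\<close>
  have "z \<in> \<phi> ` carrier ?G"
    using \<phi> z by (auto simp: iso_def bij_betw_def)
  then obtain x y where xy: "x \<in> carrier F" "y \<in> carrier F" "z = \<phi> (x, y)"
    by auto
  have ne: "y \<noteq> x [^]\<^bsub>F\<^esub> (3::nat)"
    using z xy by (auto simp: cube_graph_def)
  have "(2::nat) ^ 6 \<le> 2 ^ n" using n by (intro power_increasing) auto
  then have "1 / 18 * 2 ^ n \<le> real (card (covers ?G (cube_graph F) (x, y)))"
    using card_covers_cube_graph_ge[OF xy(1,2) ne] F by simp
  also have "card (covers ?G (cube_graph F) (x, y))
      = card (covers (Z2_power (2 * n)) (\<phi> ` cube_graph F) z)"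
    unfolding xy(3)
  proof (rule card_covers_iso[symmetric, OF _ \<phi>])
    show "monoid ?G" by (intro DirProd_monoid add.monoid_axioms)
    show "cube_graph F \<subseteq> carrier ?G" by (auto simp: cube_graph_def)
    show "(x, y) \<in> carrier ?G" using xy by simp
  qed
  finally show "1 / 18 * 2 ^ n \<le> real (card (covers (Z2_power (2 * n)) (\<phi> ` cube_graph F) z))" .
qed simp

end
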